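(* Let $\alpha\ge 2$ be an integer, let $N\ge 3$ be an integer, and let $f(x)=\dfrac{1}{x\,\log x\,(\log\log x)^{\alpha}}$ for real $x>e$. Then $$\sum_{k=3}^{\infty}\frac{1}{k\log k(\log\log k)^{\alpha}}=\sum_{k=3}^{N}\frac{1}{k\log k(\log\log k)^{\alpha}}+I_N^{(\alpha)}-\sum_{s=1}^{\infty}\frac{1}{4^{s}(2s+1)!}\sum_{k=N+1}^{\infty}f^{(2s)}(k),$$ where $$I_N^{(\alpha)}=\int_{N+1/2}^{\infty}\frac{dx}{x\log x(\log\log x)^{\alpha}}=\frac{1}{(\alpha-1)\left[\log\log\left(N+\tfrac12\right)\right]^{\alpha-1}}.$$
   Context: Here $\log$ is the natural logarithm, $\log\log x=\log(\log x)$, and $f^{(2s)}(k)$ denotes the derivative of order $2s$ of $f$ evaluated at $x=k$. *)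

theory Defs
  imports "HOL-Analysis.Analysis"
begin

(* Only the values at x > e matter: there ln (ln x) > 0 and the denominator is nonzero. *)
definition loglog_fun :: "nat \<Rightarrow> real \<Rightarrow> real" where
  "loglog_fun \<alpha> x = 1 / (x * ln x * (ln (ln x)) ^ \<alpha>)"

definition nth_deriv :: "nat \<Rightarrow> (real \<Rightarrow> real) \<Rightarrow> real \<Rightarrow> real" where
  "nth_deriv n f = (deriv ^^ n) f"

(* Henstock-Kurzweil integral over an unbounded interval, which covers improper Riemann integrals. *)
definition tail_integral :: "nat \<Rightarrow> nat \<Rightarrow> real" where
  "tail_integral \<alpha> N = integral {real N + 1 / 2 ..} (loglog_fun \<alpha>)"

(* The series over k >= m of a k, as the limit of its partial sums. Like suminf, it is only
   meaningful together with summable_from. *)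
definition summable_from :: "nat \<Rightarrow> (nat \<Rightarrow> real) \<Rightarrow> bool" where
  "summable_from m a \<longleftrightarrow> summable (\<lambda>j. a (m + j))"

definition sum_from :: "nat \<Rightarrow> (nat \<Rightarrow> real) \<Rightarrow> real" where
  "sum_from m a = (\<Sum>j. a (m + j))"

end

(* On Re z > e both log z and log log z have positive real part, so f extends holomorphically
   there, with primitive G z = -1 / ((alpha - 1) (log log z)^(alpha - 1)).  The odd part of the
   Taylor series of G at k gives
     G (k + 1/2) - G (k - 1/2) = sum over s >= 0 of f^(2s)(k) / (4^s (2s + 1)!),
   and the left-hand sides telescope to -G (N + 1/2) over k > N.  Since |f z| <= f (Re z), Cauchy's
   inequality on the unit disc around k yields |f^(2s)(k)| <= (2s)! f (k - 1), so the double series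
   is dominated by the sum of 4^(-s) f (k - 1) and the order of summation may be exchanged. *)

theory Submission
  imports Defs "HOL-Complex_Analysis.Complex_Analysis" "HOL-Real_Asymp.Real_Asymp"
begin

section \<open>General tools: double series, derivatives along the real axis, central
  differences\<close>

lemma suminf_swap_dominated:
  fixes a :: "nat \<Rightarrow> nat \<Rightarrow> real"
  assumes bound: "\<And>m n. \<bar>a m n\<bar> \<le> c m * g n"
    and c: "summable c" "\<And>m. 0 \<le> c m" and g: "summable g" "\<And>n. 0 \<le> g n"
  shows "summable (a m)" and "summable (\<lambda>m. \<Sum>n. a m n)"
    and "(\<Sum>m. \<Sum>n. a m n) = (\<Sum>n. \<Sum>m. a m n)"
proof -
  have row_abs: "summable (\<lambda>n. norm (a m n))" for m
    by (rule summable_comparison_test'[OF summable_mult[OF g(1), of "c m"]]) (use bound in simp)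
  have col_abs: "summable (\<lambda>m. norm (a m n))" for n
    by (rule summable_comparison_test'[OF summable_mult2[OF c(1), of "g n"]]) (use bound in simp)
  show "summable (a m)"
    by (rule summable_norm_cancel[OF row_abs])
  have row: "(a m has_sum (\<Sum>n. a m n)) UNIV" for m
    by (rule norm_summable_imp_has_sum[OF row_abs summable_sums[OF summable_norm_cancel[OF row_abs]]])
  have col: "((\<lambda>m. a m n) has_sum (\<Sum>m. a m n)) UNIV" for n
    by (rule norm_summable_imp_has_sum[OF col_abs summable_sums[OF summable_norm_cancel[OF col_abs]]])
  \<comment> \<open>The product majorant is nonnegative, with row sums \<open>c m\<close> times the
    total of \<open>g\<close>, so it is summable over all pairs. Hence \<open>a\<close> is
    absolutely summable over pairs, and both iterated sums equal its unordered sum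
    \<open>S\<close>.\<close>
  have "(\<lambda>(m, n). c m * g n) summable_on UNIV \<times> UNIV"
  proof (rule summable_on_SigmaI)
    show "((\<lambda>n. case (m, n) of (m, n) \<Rightarrow> c m * g n) has_sum c m * (\<Sum>n. g n)) UNIV" for m
      using g by (auto intro!: has_sum_cmult_right sums_nonneg_imp_has_sum summable_sums)
    show "(\<lambda>m. c m * (\<Sum>n. g n)) summable_on UNIV"
      using c by (intro summable_on_cmult_left) (simp add: summable_on_UNIV_nonneg_real_iff)
  qed (use c g in auto)
  then have "(\<lambda>p. norm (case p of (m, n) \<Rightarrow> a m n)) summable_on UNIV \<times> UNIV"
    by (rule summable_on_comparison_test) (use bound in auto)
  then have "(\<lambda>(m, n). a m n) summable_on UNIV \<times> UNIV"
    by (rule abs_summable_summable)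
  then obtain S where S: "((\<lambda>(m, n). a m n) has_sum S) (UNIV \<times> UNIV)"
    by (auto simp: summable_on_def)
  have rows: "(\<lambda>m. \<Sum>n. a m n) sums S"
    by (rule has_sum_imp_sums[OF has_sum_SigmaD[OF S]]) (use row in simp)
  have "((\<lambda>(n, m). a m n) has_sum S) (UNIV \<times> UNIV)"
    using S by (subst (asm) has_sum_swap) (simp add: case_prod_unfold)
  then have cols: "(\<lambda>n. \<Sum>m. a m n) sums S"
    by (rule has_sum_imp_sums[OF has_sum_SigmaD]) (use col in simp)
  show "summable (\<lambda>m. \<Sum>n. a m n)" "(\<Sum>m. \<Sum>n. a m n) = (\<Sum>n. \<Sum>m. a m n)"
    using rows cols by (auto simp: sums_iff)
qed

text \<open>Induction on the order: near a real point of the open set \<open>S\<close>, the complex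
  derivative restricted to the axis is the real-valued \<open>(deriv ^^ n) f\<close>.
  Differentiating along the axis, the imaginary part is the derivative of 0 and the real part is the
  next derivative of \<open>f\<close>. Smoothness of \<open>f\<close> is thus a consequence, not a
  hypothesis.\<close>

lemma higher_deriv_of_real:
  assumes F: "F holomorphic_on S" "open S"
    and eq: "\<And>x. complex_of_real x \<in> S \<Longrightarrow> F (of_real x) = of_real (f x)"
    and x: "complex_of_real x \<in> S"
  shows "(deriv ^^ n) F (of_real x) = of_real ((deriv ^^ n) f x)"
  using x
proof (induction n arbitrary: x)
  case 0
  then show ?case using eq by simp
next
  case (Suc n)
  let ?D = "(deriv ^^ Suc n) F (of_real x)"
  have op: "open (complex_of_real -` S)"
    using F(2) by (intro open_vimage continuous_intros)
  have "((deriv ^^ n) F has_field_derivative ?D) (at (of_real x))"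
    using has_field_derivative_higher_deriv[OF F Suc.prems] .
  then have "(((deriv ^^ n) F \<circ> of_real) has_vector_derivative (1 * ?D)) (at x)"
    by (intro field_vector_diff_chain_at) (auto intro!: derivative_eq_intros)
  then have "(((deriv ^^ n) F \<circ> of_real) has_vector_derivative ?D) (at x)"
    by simp
  then have vd: "((\<lambda>y. complex_of_real ((deriv ^^ n) f y)) has_vector_derivative ?D) (at x)"
    by (rule has_vector_derivative_transform_within_open[OF _ op])
       (use Suc in auto)
  have re: "((deriv ^^ n) f has_real_derivative Re ?D) (at x)"
    using vd by (auto simp: has_real_derivative_iff_has_vector_derivative has_vector_derivative_complex_iff)
  have "((\<lambda>y::real. 0::real) has_real_derivative Im ?D) (at x)"
    using vd by (auto simp: has_vector_derivative_complex_iff)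
  then have "Im ?D = 0"
    using DERIV_const DERIV_unique by blast
  moreover have "(deriv ^^ Suc n) f x = Re ?D"
    using DERIV_imp_deriv[OF re] by simp
  ultimately show ?case
    by (simp add: complex_eq_iff)
qed

text \<open>Both \<open>z + h\<close> and \<open>z - h\<close> lie in the disc, so the two Taylor
  series at \<open>z\<close> converge and can be subtracted. For h = 1/2 the factor 2 h^(2s+1) is
  4^(-s), the weight in the theorem.\<close>

lemma central_difference_sums:
  assumes G: "G holomorphic_on ball z r" and h: "norm h < r"
  shows "(\<lambda>s. 2 * h ^ (2 * s + 1) / fact (2 * s + 1) * (deriv ^^ (2 * s + 1)) G z)
           sums (G (z + h) - G (z - h))"
proof -
  let ?t = "\<lambda>n. (deriv ^^ n) G z / fact n * (h ^ n - (- h) ^ n)"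
  have "(\<lambda>n. (deriv ^^ n) G z / fact n * (z + h - z) ^ n) sums G (z + h)"
    and "(\<lambda>n. (deriv ^^ n) G z / fact n * (z - h - z) ^ n) sums G (z - h)"
    using h by (intro holomorphic_power_series[OF G]; simp add: dist_norm)+
  from sums_diff[OF this] have "?t sums (G (z + h) - G (z - h))"
    by (simp add: algebra_simps diff_divide_distrib)
  \<comment> \<open>the even terms vanish and the odd ones double\<close>
  from sums_group[OF this, of 2]
  have "(\<lambda>s. ?t (2 * s) + ?t (2 * s + 1)) sums (G (z + h) - G (z - h))"
    by (simp add: mult.commute)
  then show ?thesis
    by (simp add: field_simps)
qed

section \<open>Holomorphic extension of f to the half-plane Re z > e\<close>

lemma half_plane_ln:
  assumes "exp 1 \<le> x" "x \<le> Re z"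
  shows "x \<le> cmod z" "ln x \<le> cmod (ln z)" "ln (ln x) \<le> cmod (ln (ln z))"
    and "ln x \<le> Re (ln z)" "ln (ln x) \<le> Re (ln (ln z))"
proof -
  have x: "x > 0" "ln x \<ge> 1"
    using assms(1) exp_gt_zero[of "1::real"] ln_mono[OF assms(1)]
    by (linarith, simp)
  show 1: "x \<le> cmod z"
    using assms(2) complex_Re_le_cmod[of z] by linarith
  then have z: "z \<noteq> 0" using x by auto
  \<comment> \<open>Since Re (ln w) = ln |w| for nonzero w, a lower bound on a modulus becomes one
    on the real part of the logarithm. That real part bounds |ln z| from below, so the argument
    repeats for the second logarithm.\<close>
  show 2: "ln x \<le> Re (ln z)"
    using x 1 z by simp
  then show 3: "ln x \<le> cmod (ln z)"
    using complex_Re_le_cmod[of "ln z"] by linarith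
  then have "0 < cmod (ln z)"
    using x by linarith
  then have lz: "ln z \<noteq> 0"
    by (rule zero_less_norm_iff[THEN iffD1])
  have "ln (ln x) \<le> ln (cmod (ln z))"
    by (rule ln_mono[OF 3]) (use x in linarith)
  then show "ln (ln x) \<le> Re (ln (ln z))"
    using lz by simp
  then show "ln (ln x) \<le> cmod (ln (ln z))"
    using complex_Re_le_cmod[of "ln (ln z)"] by linarith
qed

definition loglog_complex :: "nat \<Rightarrow> complex \<Rightarrow> complex" where
  "loglog_complex \<alpha> z = 1 / (z * ln z * ln (ln z) ^ \<alpha>)"

text \<open>Polymorphic so that one formula yields the complex primitive for the Taylor expansion
  and the real one for telescoping and the integral. The additive constant is chosen so that the
  real primitive vanishes at infinity.\<close>

definition loglog_primitive :: "nat \<Rightarrow> 'a :: {real_normed_field, ln} \<Rightarrow> 'a" where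
  "loglog_primitive \<alpha> z = - 1 / ((of_nat \<alpha> - 1) * ln (ln z) ^ (\<alpha> - 1))"

lemma ln_ln_pos:
  assumes "exp 1 < (x :: real)"
  shows "0 < x" "1 < ln x" "0 < ln (ln x)" "0 < ln x"
proof -
  show "0 < x"
    using assms exp_gt_zero[of "1::real"] by linarith
  then show "1 < ln x"
    using assms by (metis exp_less_cancel_iff exp_ln)
  then show "0 < ln (ln x)" "0 < ln x"
    by simp_all
qed

lemma loglog_fun_pos: "exp 1 < x \<Longrightarrow> 0 < loglog_fun \<alpha> x"
  using ln_ln_pos[of x] unfolding loglog_fun_def
  by (intro divide_pos_pos mult_pos_pos zero_less_power) auto

lemma ln_ln_of_real:
  assumes "exp 1 < x"
  shows "ln (complex_of_real x) = of_real (ln x)" "ln (complex_of_real (ln x)) = of_real (ln (ln x))"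
  using ln_ln_pos[OF assms] by (auto intro!: Ln_of_real)

lemma loglog_complex_of_real:
  "exp 1 < x \<Longrightarrow> loglog_complex \<alpha> (of_real x) = of_real (loglog_fun \<alpha> x)"
  by (simp add: loglog_complex_def loglog_fun_def ln_ln_of_real)

lemma loglog_primitive_of_real:
  "exp 1 < x \<Longrightarrow> loglog_primitive \<alpha> (complex_of_real x) = of_real (loglog_primitive \<alpha> x)"
  by (simp add: loglog_primitive_def ln_ln_of_real)

text \<open>Positive real parts keep \<open>z\<close> and \<open>ln z\<close> off the branch cut of
  the principal logarithm, and all three factors away from zero.\<close>

lemma half_plane_ln_nonzero:
  assumes "exp 1 < Re z"
  shows "z \<noteq> 0" "ln z \<noteq> 0" "ln (ln z) \<noteq> 0" "z \<notin> \<real>\<^sub>\<le>\<^sub>0" "ln z \<notin> \<real>\<^sub>\<le>\<^sub>0"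
proof -
  have "Re (ln (ln z)) > 0" "Re (ln z) > 0" "Re z > 0"
    using half_plane_ln[OF less_imp_le[OF assms] order_refl] ln_ln_pos[OF assms] by linarith+
  then show "z \<noteq> 0" "ln z \<noteq> 0" "ln (ln z) \<noteq> 0" "z \<notin> \<real>\<^sub>\<le>\<^sub>0" "ln z \<notin> \<real>\<^sub>\<le>\<^sub>0"
    by (auto simp: complex_nonpos_Reals_iff)
qed

lemma holomorphic_loglog_complex: "loglog_complex \<alpha> holomorphic_on {z. exp 1 < Re z}"
proof -
  have "z * ln z * ln (ln z) ^ \<alpha> \<noteq> 0" if "exp 1 < Re z" for z
    using half_plane_ln_nonzero[OF that] unfolding mult_eq_0_iff power_eq_0_iff by blast
  then show ?thesis
    unfolding loglog_complex_def
    by (intro holomorphic_intros) (use half_plane_ln_nonzero in blast)+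
qed

text \<open>Every factor of the denominator has modulus at least its value at \<open>x\<close>.
  Besides feeding Cauchy's inequality, this contains the monotonicity of f on the real axis.\<close>

lemma norm_loglog_complex_le:
  assumes "exp 1 < x" "x \<le> Re z"
  shows "norm (loglog_complex \<alpha> z) \<le> loglog_fun \<alpha> x"
proof -
  have "x * ln x * ln (ln x) ^ \<alpha> \<le> cmod z * cmod (ln z) * cmod (ln (ln z)) ^ \<alpha>"
    using half_plane_ln[of x z] ln_ln_pos[OF assms(1)] assms
    by (intro mult_mono power_mono mult_nonneg_nonneg zero_le_power norm_ge_zero; linarith)
  moreover have "0 < x * ln x * ln (ln x) ^ \<alpha>"
    using ln_ln_pos[OF assms(1)] by (intro mult_pos_pos zero_less_power)
  ultimately show ?thesis
    unfolding loglog_complex_def loglog_fun_def norm_divide norm_mult norm_power norm_one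
    by (intro frac_le) simp_all
qed

section \<open>The primitive, over the complex and the real numbers\<close>

lemma DERIV_neg_inverse_power:
  fixes u :: "'a :: real_normed_field \<Rightarrow> 'a"
  assumes "(u has_field_derivative D) (at z)" "u z \<noteq> 0" "\<alpha> \<ge> 2"
  shows "((\<lambda>w. - 1 / ((of_nat \<alpha> - 1) * u w ^ (\<alpha> - 1))) has_field_derivative D / u z ^ \<alpha>) (at z)"
proof -
  obtain m where m: "\<alpha> = Suc (Suc m)"
    using assms(3) by (metis Suc_le_D numeral_2_eq_2 Suc_le_mono)
  \<comment> \<open>This is \<alpha> - 1, written in the form in which
    \<open>DERIV_power_Suc\<close> produces it; it cancels the normalising factor of the
    primitive.\<close>
  define c :: 'a where "c = 1 + of_nat m"
  have c: "c \<noteq> 0"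
    using of_nat_neq_0[of m, where ?'a = 'a] by (simp add: c_def)
  have "((\<lambda>w. - (1 / c) * inverse (u w ^ Suc m)) has_field_derivative
      - (1 / c) * - (inverse (u z ^ Suc m) * (c * (D * u z ^ m)) * inverse (u z ^ Suc m))) (at z)"
    unfolding c_def
    by (intro DERIV_cmult DERIV_inverse' DERIV_power_Suc assms(1) power_not_zero assms(2))
  moreover have "- (1 / c) * - (inverse (u z ^ Suc m) * (c * (D * u z ^ m)) * inverse (u z ^ Suc m))
      = D / u z ^ \<alpha>"
    using c assms(2) by (simp add: m field_simps)
  moreover have "(\<lambda>w. - (1 / c) * inverse (u w ^ Suc m)) = (\<lambda>w. - 1 / ((of_nat \<alpha> - 1) * u w ^ (\<alpha> - 1)))"
    by (simp add: m c_def divide_inverse fun_eq_iff)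
  ultimately show ?thesis
    by simp
qed

lemma DERIV_loglog_primitive_complex:
  assumes "\<alpha> \<ge> 2" "exp 1 < Re z"
  shows "(loglog_primitive \<alpha> has_field_derivative loglog_complex \<alpha> z) (at z)"
proof -
  note nz = half_plane_ln_nonzero[OF assms(2)]
  have "((\<lambda>w. ln (ln w)) has_field_derivative inverse (ln z) * inverse z) (at z)"
    by (rule DERIV_chain2[OF has_field_derivative_Ln[OF nz(5)] has_field_derivative_Ln[OF nz(4)]])
  from DERIV_neg_inverse_power[OF this nz(3) assms(1)] show ?thesis
    by (simp add: loglog_primitive_def[abs_def] loglog_complex_def field_simps)
qed

lemma DERIV_loglog_primitive_real:
  assumes "\<alpha> \<ge> 2" "exp 1 < x"
  shows "(loglog_primitive \<alpha> has_real_derivative loglog_fun \<alpha> x) (at x)"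
proof -
  have pos: "0 < x" "0 < ln x" "ln (ln x) \<noteq> 0"
    using ln_ln_pos[OF assms(2)] by linarith+
  have "((\<lambda>w. ln (ln w)) has_real_derivative inverse (ln x) * inverse x) (at x)"
    by (rule DERIV_chain2[OF DERIV_ln[OF pos(2)] DERIV_ln[OF pos(1)]])
  from DERIV_neg_inverse_power[OF this pos(3) assms(1)] show ?thesis
    by (simp add: loglog_primitive_def[abs_def] loglog_fun_def field_simps)
qed

lemma loglog_primitive_tendsto_0:
  assumes "\<alpha> \<ge> 2"
  shows "((loglog_primitive \<alpha> :: real \<Rightarrow> real) \<longlongrightarrow> 0) at_top"
proof -
  have "((\<lambda>x::real. inverse (ln (ln x))) \<longlongrightarrow> 0) at_top"
    by real_asymp
  then have "((\<lambda>x. - 1 / (real \<alpha> - 1) * inverse (ln (ln x)) ^ (\<alpha> - 1)) \<longlongrightarrow>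
      - 1 / (real \<alpha> - 1) * 0 ^ (\<alpha> - 1)) at_top"
    by (intro tendsto_intros)
  \<comment> \<open>The exponent \<alpha> - 1 is positive, so the limit
    \<open>0 ^ (\<alpha> - 1)\<close> is 0 and not 1.\<close>
  then show ?thesis
    using assms by (simp add: loglog_primitive_def[abs_def] field_simps power_0_left)
qed

section \<open>Derivatives of f: Cauchy bounds and the midpoint expansion\<close>

lemma loglog_higher_deriv_of_real:
  assumes "exp 1 < x"
  shows "(deriv ^^ n) (loglog_complex \<alpha>) (of_real x) = of_real (nth_deriv n (loglog_fun \<alpha>) x)"
  unfolding nth_deriv_def
  by (rule higher_deriv_of_real[OF holomorphic_loglog_complex open_halfspace_Re_gt])
     (use assms loglog_complex_of_real in auto)

lemma nth_deriv_loglog_bound: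
  assumes "exp 1 + 1 < x"
  shows "\<bar>nth_deriv n (loglog_fun \<alpha>) x\<bar> \<le> fact n * loglog_fun \<alpha> (x - 1)"
proof -
  have Re: "x - 1 \<le> Re z" if "cmod (of_real x - z) \<le> 1" for z
    using complex_Re_le_cmod[of "of_real x - z"] that by simp
  have sub: "cball (complex_of_real x) 1 \<subseteq> {z. exp 1 < Re z}"
    using Re assms by (force simp: dist_norm)
  \<comment> \<open>Real parts on the closed unit disc are at least x - 1 > e, which bounds the
    function there by its value at x - 1. Radius 1 adds no exponential factor to the
    factorial.\<close>
  have "norm ((deriv ^^ n) (loglog_complex \<alpha>) (of_real x)) \<le> fact n * loglog_fun \<alpha> (x - 1) / 1 ^ n"
  proof (rule Cauchy_inequality)
    show "loglog_complex \<alpha> holomorphic_on ball (of_real x) 1"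
      using holomorphic_loglog_complex sub ball_subset_cball holomorphic_on_subset by blast
    show "continuous_on (cball (of_real x) 1) (loglog_complex \<alpha>)"
      using holomorphic_loglog_complex sub holomorphic_on_imp_continuous_on holomorphic_on_subset
      by blast
  qed (use assms Re in \<open>auto intro!: norm_loglog_complex_le\<close>)
  then show ?thesis
    using assms by (simp add: loglog_higher_deriv_of_real)
qed

lemma loglog_midpoint_expansion:
  assumes "\<alpha> \<ge> 2" "exp 1 + 1 \<le> x"
  shows "(\<lambda>s. nth_deriv (2 * s) (loglog_fun \<alpha>) x / (4 ^ s * fact (2 * s + 1)))
           sums (loglog_primitive \<alpha> (x + 1 / 2) - loglog_primitive \<alpha> (x - 1 / 2))"
proof -
  let ?H = "{z. exp 1 < Re z}" and ?G = "loglog_primitive \<alpha> :: complex \<Rightarrow> complex"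
  have G: "?G holomorphic_on ?H"
    unfolding holomorphic_on_open[OF open_halfspace_Re_gt]
    using DERIV_loglog_primitive_complex[OF assms(1)] by blast
  have "ball (complex_of_real x) 1 \<subseteq> ?H"
  proof
    fix z assume "z \<in> ball (complex_of_real x) 1"
    then show "z \<in> ?H"
      using complex_Re_le_cmod[of "of_real x - z"] assms(2) by (simp add: dist_norm)
  qed
  then have "?G holomorphic_on ball (of_real x) 1"
    using G holomorphic_on_subset by blast
  \<comment> \<open>The step 1/2 lies strictly inside the radius 1.\<close>
  from central_difference_sums[OF this, of "1 / 2"]
  have sums: "(\<lambda>s. 2 * (1 / 2) ^ (2 * s + 1) / fact (2 * s + 1) * (deriv ^^ (2 * s + 1)) ?G (of_real x))
      sums (?G (of_real x + 1 / 2) - ?G (of_real x - 1 / 2))"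
    by (simp add: norm_divide)
  have deriv: "(deriv ^^ (2 * s + 1)) ?G (of_real x) = of_real (nth_deriv (2 * s) (loglog_fun \<alpha>) x)" for s
  proof -
    have "(deriv ^^ (2 * s + 1)) ?G (of_real x) = (deriv ^^ (2 * s)) (deriv ?G) (of_real x)"
      by (simp add: funpow_swap1)
    \<comment> \<open>The first derivative of the primitive is known to be f only on the half-plane;
      its openness lets the equality pass to higher derivatives.\<close>
    also have "\<dots> = (deriv ^^ (2 * s)) (loglog_complex \<alpha>) (of_real x)"
      by (rule higher_deriv_transform_within_open[OF holomorphic_deriv[OF G open_halfspace_Re_gt]
            holomorphic_loglog_complex open_halfspace_Re_gt])
         (use assms DERIV_imp_deriv[OF DERIV_loglog_primitive_complex[OF assms(1)]] in auto)
    finally show ?thesis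
      using assms by (simp add: loglog_higher_deriv_of_real)
  qed
  have ends: "?G (of_real x + 1 / 2) = of_real (loglog_primitive \<alpha> (x + 1 / 2))"
    "?G (of_real x - 1 / 2) = of_real (loglog_primitive \<alpha> (x - 1 / 2))"
    using loglog_primitive_of_real[of "x + 1 / 2" \<alpha>] loglog_primitive_of_real[of "x - 1 / 2" \<alpha>] assms
    by simp_all
  have coeff: "2 * (1 / 2) ^ (2 * s + 1) / fact (2 * s + 1) = complex_of_real (1 / (4 ^ s * fact (2 * s + 1)))" for s
    by (simp add: power_mult power_divide)
  have "(\<lambda>s. complex_of_real (nth_deriv (2 * s) (loglog_fun \<alpha>) x / (4 ^ s * fact (2 * s + 1)))) sums
      of_real (loglog_primitive \<alpha> (x + 1 / 2) - loglog_primitive \<alpha> (x - 1 / 2))"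
    using sums unfolding deriv ends coeff by (simp flip: of_real_mult of_real_diff)
  then show ?thesis
    by (simp only: sums_of_real_iff)
qed

section \<open>The tail integral and convergence of the series of f\<close>

lemma loglog_tail_has_integral:
  assumes "\<alpha> \<ge> 2" "exp 1 < a"
  shows "(loglog_fun \<alpha> has_integral - loglog_primitive \<alpha> a) {a..}"
proof (rule has_integral_to_inf)
  have I: "(loglog_fun \<alpha> has_integral (loglog_primitive \<alpha> y - loglog_primitive \<alpha> a)) {a..y}"
    if "a \<le> y" for y
    using that assms DERIV_loglog_primitive_real[OF assms(1)]
    by (intro fundamental_theorem_of_calculus)
       (auto simp flip: has_real_derivative_iff_has_vector_derivative
          intro: has_field_derivative_at_within)
  show "loglog_fun \<alpha> integrable_on {a..y}" for y
    using I[of y] by (cases "a \<le> y") (auto simp: integrable_on_def)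
  have "((\<lambda>y. loglog_primitive \<alpha> y - loglog_primitive \<alpha> a) \<longlongrightarrow> 0 - loglog_primitive \<alpha> a) at_top"
    by (intro tendsto_intros loglog_primitive_tendsto_0 assms)
  moreover have "\<forall>\<^sub>F y in at_top. loglog_primitive \<alpha> y - loglog_primitive \<alpha> a = integral {a..y} (loglog_fun \<alpha>)"
    using integral_unique[OF I] by (intro eventually_at_top_linorderI[of a]) simp
  ultimately show "((\<lambda>y. integral {a..y} (loglog_fun \<alpha>)) \<longlongrightarrow> - loglog_primitive \<alpha> a) at_top"
    by (simp add: filterlim_cong)
  \<comment> \<open>Nonnegativity is what turns the limit of the integrals over
    \<open>{a..y}\<close> into an integral over the half-line.\<close>
  show "0 \<le> loglog_fun \<alpha> y" if "a \<le> y" for y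
    using loglog_fun_pos[of y \<alpha>] assms that by simp
qed

lemma loglog_primitive_shift_LIMSEQ:
  assumes "\<alpha> \<ge> 2"
  shows "(\<lambda>n. loglog_primitive \<alpha> (c + real n)) \<longlonglongrightarrow> (0 :: real)"
proof -
  have "filterlim (\<lambda>n. c + real n) at_top sequentially"
    by real_asymp
  from filterlim_compose[OF loglog_primitive_tendsto_0[OF assms] this] show ?thesis .
qed

text \<open>The integral test in telescoping form: by the mean value theorem and monotonicity, each
  term after the first is at most an increment of the primitive, and these increments telescope to a
  finite limit.\<close>

lemma summable_loglog:
  assumes "\<alpha> \<ge> 2" "exp 1 < a"
  shows "summable (\<lambda>n. loglog_fun \<alpha> (a + real n))"
proof -
  let ?G = "\<lambda>n. loglog_primitive \<alpha> (a + real n)"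
  have le: "loglog_fun \<alpha> (a + real (Suc n)) \<le> ?G (Suc n) - ?G n" for n
  proof -
    have "\<exists>z>a + real n. z < a + real (Suc n) \<and>
        ?G (Suc n) - ?G n = (a + real (Suc n) - (a + real n)) * loglog_fun \<alpha> z"
      using assms by (intro MVT2 DERIV_loglog_primitive_real) auto
    then obtain z where z: "a + real n < z" "z < a + real (Suc n)" "?G (Suc n) - ?G n = loglog_fun \<alpha> z"
      by auto
    \<comment> \<open>Passing through the complex norm makes \<open>norm_loglog_complex_le\<close>
      supply the monotonicity.\<close>
    have "loglog_fun \<alpha> (a + real (Suc n)) = norm (loglog_complex \<alpha> (of_real (a + real (Suc n))))"
      using assms loglog_fun_pos[of "a + real (Suc n)" \<alpha>]
      by (subst loglog_complex_of_real) (auto simp del: of_real_add)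
    also have "\<dots> \<le> loglog_fun \<alpha> z"
      using z assms by (intro norm_loglog_complex_le) auto
    finally show ?thesis using z by simp
  qed
  have "summable (\<lambda>n. loglog_fun \<alpha> (a + real (Suc n)))"
  proof (rule summable_comparison_test'[OF telescope_summable])
    show "?G \<longlonglongrightarrow> 0"
      by (rule loglog_primitive_shift_LIMSEQ[OF assms(1)])
    show "norm (loglog_fun \<alpha> (a + real (Suc n))) \<le> ?G (Suc n) - ?G n" for n
      using le[of n] loglog_fun_pos[of "a + real (Suc n)" \<alpha>] assms by simp
  qed
  then show ?thesis
    by (subst summable_Suc_iff[symmetric])
qed

section \<open>Exchange of summation and assembly of the identity\<close>

theorem mainTheorem2:
  fixes \<alpha> N :: nat
  assumes "\<alpha> \<ge> 2" and "N \<ge> 3"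
  shows "summable_from 3 (\<lambda>k. loglog_fun \<alpha> (real k))
    \<and> loglog_fun \<alpha> integrable_on {real N + 1 / 2 ..}
    \<and> (\<forall>s\<ge>1. summable_from (N + 1) (\<lambda>k. nth_deriv (2 * s) (loglog_fun \<alpha>) (real k)))
    \<and> summable_from 1 (\<lambda>s. 1 / (4 ^ s * fact (2 * s + 1))
          * sum_from (N + 1) (\<lambda>k. nth_deriv (2 * s) (loglog_fun \<alpha>) (real k)))
    \<and> sum_from 3 (\<lambda>k. loglog_fun \<alpha> (real k))
        = (\<Sum>k=3..N. loglog_fun \<alpha> (real k)) + tail_integral \<alpha> N
          - sum_from 1 (\<lambda>s. 1 / (4 ^ s * fact (2 * s + 1))
              * sum_from (N + 1) (\<lambda>k. nth_deriv (2 * s) (loglog_fun \<alpha>) (real k)))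
    \<and> tail_integral \<alpha> N = 1 / ((real \<alpha> - 1) * (ln (ln (real N + 1 / 2))) ^ (\<alpha> - 1))"
proof -
  have e: "exp 1 < (3 :: real)"
    using e_less_272 by linarith
  have N: "3 \<le> real N"
    using assms(2) by simp
  let ?f = "loglog_fun \<alpha>" and ?P = "loglog_primitive \<alpha> :: real \<Rightarrow> real"
  let ?d = "\<lambda>s n. nth_deriv (2 * s) ?f (real (N + 1 + n))"
  define b where "b s = 1 / (4 ^ s * fact (2 * s + 1) :: real)" for s
  have b_pos: "b s > 0" for s
    by (simp add: b_def)

  \<comment> \<open>Cauchy's bound at k = N + 1 + n costs a shift by one, so the majorant starts at
    N; N \<ge> 3 > e keeps it in the domain.\<close>
  have bound: "\<bar>?d s n\<bar> \<le> fact (2 * s) * ?f (real N + real n)" for s n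
    using nth_deriv_loglog_bound[of "real (N + 1 + n)" "2 * s" \<alpha>] e N by (simp add: add_ac)
  have g: "summable (\<lambda>n. ?f (real N + real n))" "0 \<le> ?f (real N + real n)" for n
    using summable_loglog[OF assms(1), of "real N"] loglog_fun_pos[of "real N + real n" \<alpha>] e N
    by (auto intro: less_imp_le)
  have term_bound: "\<bar>b s * ?d s n\<bar> \<le> (1 / 4) ^ s * ?f (real N + real n)" for s n
  proof -
    \<comment> \<open>The factorial from Cauchy's inequality is absorbed by the one in
      \<open>b s\<close>, leaving the geometric factor 4^(-s).\<close>
    have "fact (2 * s) / fact (2 * s + 1) \<le> (1 :: real)"
      using fact_mono[of "2 * s" "2 * s + 1", where ?'a = real] fact_gt_zero[of "2 * s + 1", where ?'a = real]
      by (simp del: fact_Suc)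
    then have "(1 / 4) ^ s * (fact (2 * s) / fact (2 * s + 1)) \<le> (1 / 4 :: real) ^ s * 1"
      by (intro mult_left_mono) simp_all
    then have "b s * fact (2 * s) \<le> (1 / 4) ^ s"
      by (simp add: b_def power_divide del: fact_Suc)
    moreover have "\<bar>b s * ?d s n\<bar> \<le> b s * (fact (2 * s) * ?f (real N + real n))"
      using bound[of s n] b_pos[of s] by (simp add: abs_mult)
    ultimately show ?thesis
      using mult_right_mono[OF _ g(2)[of n]] by (fastforce simp: mult.assoc)
  qed
  have geo: "summable (\<lambda>s. (1 / 4 :: real) ^ s)" "0 \<le> (1 / 4 :: real) ^ s" for s
    by (auto intro: summable_geometric)
  note swap = suminf_swap_dominated[OF term_bound geo g]

  have sum_d: "summable (?d s)" for s
    using swap(1)[of s] b_pos[of s] by (simp add: summable_cmult_iff)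
  have row: "(\<Sum>n. b s * ?d s n) = b s * (\<Sum>n. ?d s n)" for s
    by (rule suminf_mult[OF sum_d])
  \<comment> \<open>The unit interval centred at N + 1 + n has endpoints N + 1/2 + n and N + 1/2 +
    (n + 1), so consecutive columns share an endpoint and telescope.\<close>
  have col: "(\<Sum>s. b s * ?d s n) = ?P (real N + 1 / 2 + real (Suc n)) - ?P (real N + 1 / 2 + real n)" for n
    using loglog_midpoint_expansion[OF assms(1), of "real (N + 1 + n)"] e N
    by (auto simp: sums_iff b_def algebra_simps)
  have total: "(\<Sum>n. \<Sum>s. b s * ?d s n) = - ?P (real N + 1 / 2)"
    unfolding col
    using telescope_sums[OF loglog_primitive_shift_LIMSEQ[OF assms(1), of "real N + 1 / 2"]]
    by (simp add: sums_iff)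

  have T: "summable (\<lambda>s. b s * (\<Sum>n. ?d s n))"
    using swap(2) unfolding row .
  have "(\<Sum>s. b s * (\<Sum>n. ?d s n)) = - ?P (real N + 1 / 2)"
    using swap(3) unfolding total row .
  \<comment> \<open>The term s = 0 has \<open>b 0 = 1\<close> and derivative of order 0, so it is
    the tail of the original series over k > N.\<close>
  then have split: "(\<Sum>n. ?f (real (N + 1 + n))) + (\<Sum>s. b (Suc s) * (\<Sum>n. ?d (Suc s) n)) = - ?P (real N + 1 / 2)"
    using suminf_split_head[OF T] by (simp add: b_def nth_deriv_def)

  have int: "(?f has_integral - ?P (real N + 1 / 2)) {real N + 1 / 2 ..}"
    using e N by (intro loglog_tail_has_integral assms) simp
  then have tail: "tail_integral \<alpha> N = - ?P (real N + 1 / 2)"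
    by (simp add: tail_integral_def integral_unique)

  have sum_f: "summable (\<lambda>j. ?f (real (3 + j)))"
    using summable_loglog[OF assms(1) e] by simp
  \<comment> \<open>With k = 3 + j, the N - 2 indices j < N - 2 are exactly k = 3, ..., N; the
    truncated subtraction is exact because N \<ge> 3.\<close>
  have "(\<Sum>j. ?f (real (3 + j))) = (\<Sum>j. ?f (real (3 + (j + (N - 2))))) + (\<Sum>j<N - 2. ?f (real (3 + j)))"
    by (rule suminf_split_initial_segment[OF sum_f])
  also have "(\<Sum>j<N - 2. ?f (real (3 + j))) = (\<Sum>k=3..N. ?f (real k))"
    by (rule sum.reindex_bij_witness[of _ "\<lambda>k. k - 3" "\<lambda>j. 3 + j"]) auto
  also have "(\<lambda>j. ?f (real (3 + (j + (N - 2))))) = (\<lambda>j. ?f (real (N + 1 + j)))"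
    using assms(2) by (intro ext arg_cong[of _ _ "\<lambda>n. ?f (real n)"]) linarith
  finally have head: "(\<Sum>j. ?f (real (3 + j))) = (\<Sum>n. ?f (real (N + 1 + n))) + (\<Sum>k=3..N. ?f (real k))" .

  show ?thesis
    unfolding summable_from_def sum_from_def b_def[symmetric]
  proof (intro conjI allI impI)
    show "summable (\<lambda>j. ?f (real (3 + j)))"
      by (rule sum_f)
    show "?f integrable_on {real N + 1 / 2 ..}"
      using int by blast
    show "summable (?d s)" for s
      by (rule sum_d)
    show "summable (\<lambda>s. b (1 + s) * (\<Sum>n. ?d (1 + s) n))"
      using summable_ignore_initial_segment[OF T, of 1] by (simp only: add.commute)
    show "(\<Sum>j. ?f (real (3 + j))) = (\<Sum>k=3..N. ?f (real k)) + tail_integral \<alpha> N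
        - (\<Sum>s. b (1 + s) * (\<Sum>n. ?d (1 + s) n))"
      using head split tail by simp
    show "tail_integral \<alpha> N = 1 / ((real \<alpha> - 1) * ln (ln (real N + 1 / 2)) ^ (\<alpha> - 1))"
      by (simp add: tail loglog_primitive_def)
  qed
qed

end
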